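(* For every integer $n \ge 4$, \[ \hat{R}(\mathcal{K}_n^{(3)}) \ge \frac{n^2}{96}\binom{R(\mathcal{K}_n^{(3)})}{2}. \]
   Context: A $k$-uniform hypergraph ($k$-graph) is a vertex set together with a family of $k$-element subsets (edges). $\mathcal{K}_n^{(k)}$ denotes the complete $k$-graph on $n$ vertices. For $k$-graphs $\mathcal{G},\mathcal{H}$, write $\mathcal{H}\to\mathcal{G}$ if every 2-coloring of the edges of $\mathcal{H}$ contains a monochromatic (not necessarily induced) copy of $\mathcal{G}$. The Ramsey number $R(\mathcal{G})$ is the least $N$ with $\mathcal{K}_N^{(k)}\to\mathcal{G}$. The size-Ramsey number is $\hat{R}(\mathcal{G})=\min\{|E(\mathcal{H})| : \mathcal{H}\to\mathcal{G}\}$. *)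

theory Defs
  imports Complex_Main "HOL-Library.Ramsey"
begin

type_synonym 'a hypergraph = "'a set \<times> 'a set set"

abbreviation verts :: "'a hypergraph \<Rightarrow> 'a set" where
  "verts H \<equiv> fst H"

abbreviation edges :: "'a hypergraph \<Rightarrow> 'a set set" where
  "edges H \<equiv> snd H"

definition kgraph :: "nat \<Rightarrow> 'a hypergraph \<Rightarrow> bool" where
  "kgraph k H \<longleftrightarrow> finite (verts H) \<and> (\<forall>e\<in>edges H. e \<subseteq> verts H \<and> card e = k)"

definition complete_kgraph :: "nat \<Rightarrow> nat \<Rightarrow> nat hypergraph" where
  "complete_kgraph k n = ({..<n}, {e. e \<subseteq> {..<n} \<and> card e = k})"

definition embedding :: "('b \<Rightarrow> 'a) \<Rightarrow> 'b hypergraph \<Rightarrow> 'a hypergraph \<Rightarrow> bool" where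
  "embedding f G H \<longleftrightarrow>
     inj_on f (verts G) \<and> f ` verts G \<subseteq> verts H \<and> (\<forall>e\<in>edges G. f ` e \<in> edges H)"

(* The values of a colouring outside the edge set of H are irrelevant. *)
definition arrows :: "'a hypergraph \<Rightarrow> 'b hypergraph \<Rightarrow> bool" where
  "arrows H G \<longleftrightarrow>
     (\<forall>\<chi> :: 'a set \<Rightarrow> bool. \<exists>f. embedding f G H \<and> (\<exists>c. \<forall>e\<in>edges G. \<chi> (f ` e) = c))"

definition ramsey_number :: "nat \<Rightarrow> 'b hypergraph \<Rightarrow> nat" where
  "ramsey_number k G = (LEAST N. arrows (complete_kgraph k N) G)"

(* Every finite hypergraph is isomorphic to one whose vertices are natural numbers, so letting
   H range over nat hypergraphs loses nothing. *)
definition size_ramsey_number :: "nat \<Rightarrow> 'b hypergraph \<Rightarrow> nat" where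
  "size_ramsey_number k G =
     (LEAST m. \<exists>H :: nat hypergraph. kgraph k H \<and> arrows H G \<and> m = card (edges H))"

(* By Ramsey's theorem the least elements above exist for complete hypergraphs. *)
lemma arrows_complete_kgraph_ex: "\<exists>N. arrows (complete_kgraph k N) (complete_kgraph k n)"
proof -
  obtain N :: nat where N: "partn_lst {..<N} [n, n] k"
    using ramsey_full[of "[n, n]" k] by blast
  have "arrows (complete_kgraph k N) (complete_kgraph k n)"
    unfolding arrows_def
  proof
    fix \<chi> :: "nat set \<Rightarrow> bool"
    define g where "g e = (if \<chi> e then 1 else 0 :: nat)" for e
    have "g \<in> nsets {..<N} k \<rightarrow> {..<2}"
      by (auto simp: g_def)
    then obtain i A where i: "i < length [n, n]" and A: "A \<in> nsets {..<N} ([n, n] ! i)"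
      and mono: "g ` nsets A k \<subseteq> {i}"
      by (rule partn_lstE[OF N]) auto
    have "A \<in> nsets {..<N} n"
      using i A by (auto simp: less_Suc_eq)
    then have sub: "A \<subseteq> {..<N}" and fin: "finite A" and card: "card A = n"
      by (auto simp: nsets_def)
    obtain f where f: "bij_betw f {..<n} A"
      using ex_bij_betw_nat_finite[OF fin] card by (auto simp: atLeast0LessThan)
    have img: "f ` e \<in> nsets A k" if "e \<subseteq> {..<n}" "card e = k" for e
    proof -
      have "inj_on f e" "f ` e \<subseteq> A"
        using f that by (auto simp: bij_betw_def intro: inj_on_subset)
      then show ?thesis
        using that fin by (auto simp: nsets_def card_image intro: finite_subset)
    qed
    have "embedding f (complete_kgraph k n) (complete_kgraph k N)"
      unfolding embedding_def
    proof (intro conjI ballI)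
      show "inj_on f (verts (complete_kgraph k n))"
        using f by (simp add: complete_kgraph_def bij_betw_def)
      show "f ` verts (complete_kgraph k n) \<subseteq> verts (complete_kgraph k N)"
        using f sub by (simp add: complete_kgraph_def bij_betw_def)
      fix e assume "e \<in> edges (complete_kgraph k n)"
      then have "f ` e \<in> nsets A k"
        using img by (simp add: complete_kgraph_def)
      then show "f ` e \<in> edges (complete_kgraph k N)"
        using sub unfolding nsets_def complete_kgraph_def snd_conv by blast
    qed
    moreover have "\<forall>e\<in>edges (complete_kgraph k n). \<chi> (f ` e) = (i = 1)"
    proof
      fix e assume "e \<in> edges (complete_kgraph k n)"
      then have "g (f ` e) = i"
        using img mono unfolding complete_kgraph_def snd_conv by blast
      then show "\<chi> (f ` e) = (i = 1)"
        by (auto simp: g_def split: if_splits)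
    qed
    ultimately show "\<exists>f. embedding f (complete_kgraph k n) (complete_kgraph k N) \<and>
        (\<exists>c. \<forall>e\<in>edges (complete_kgraph k n). \<chi> (f ` e) = c)"
      by blast
  qed
  then show ?thesis ..
qed

lemma kgraph_complete_kgraph: "kgraph k (complete_kgraph k n)"
  by (auto simp: kgraph_def complete_kgraph_def)

end

theory Submission
  imports Defs
begin

text \<open>
  Put \<open>m = n - 2\<close> and call a pair of vertices heavy if it lies in at least \<open>m\<^sup>2\<close> edges of \<open>H\<close>.
  If the heavy pairs number less than \<open>R choose 2\<close>, they form a graph with a proper colouring \<open>\<phi>\<close> in
  \<open>R - 1\<close> colours. Pulling back along \<open>\<phi>\<close> a colouring of the complete 3-graph on \<open>R - 1\<close> vertices
  without monochromatic \<open>n\<close>-clique, every monochromatic \<open>n\<close>-clique of \<open>H\<close> contains a light pair.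
  The light pairs \<open>{u, v}\<close> are repaired one at a time, by recolouring only the edges \<open>{u, v, w}\<close>.
  The colours of the triples \<open>{u, w, w'}\<close> induce a colouring of the pairs of the common
  neighbourhood \<open>W\<close>, in which a red and a blue clique share at most one vertex. Let \<open>B\<close> be the
  union of a maximal family of disjoint red \<open>m\<close>-cliques in \<open>W\<close>. As \<open>|W| < m\<^sup>2\<close>, there are fewer than
  \<open>m\<close> of these, so that \<open>B\<close> contains no blue \<open>m\<close>-clique, while \<open>W - B\<close> contains no red one. Colouring
  \<open>{u, v, w}\<close> blue for \<open>w \<in> B\<close> and red for \<open>w \<in> W - B\<close> therefore destroys all monochromatic
  \<open>n\<close>-cliques through \<open>u, v\<close> and creates no new ones. Consequently
  \<open>|E(H)| \<ge> m\<^sup>2 / 3 * (R choose 2)\<close>.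
\<close>

section \<open>Cliques and the repair of light pairs\<close>

definition hyperclique :: "'a hypergraph \<Rightarrow> 'a set \<Rightarrow> bool" where
  "hyperclique H K \<longleftrightarrow> K \<subseteq> verts H \<and> nsets K 3 \<subseteq> edges H"

definition mono_triples :: "('a set \<Rightarrow> bool) \<Rightarrow> 'a set \<Rightarrow> bool" where
  "mono_triples \<chi> K \<longleftrightarrow> (\<exists>c. \<forall>e\<in>nsets K 3. \<chi> e = c)"

text \<open>Call a pair red if \<open>c\<close> holds and blue otherwise. Induction on
  \<open>s\<close>: moving one red \<open>m\<close>-clique into \<open>B\<close> uses up
  \<open>m\<close> vertices of \<open>W\<close>, and it lengthens a blue clique in \<open>B\<close>
  by at most one vertex, since two vertices inside the red clique form a red pair.\<close>

lemma split_cliques: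
  assumes "finite W" "card W < s * m"
  shows "\<exists>B\<subseteq>W. (\<forall>Q\<subseteq>W - B. card Q = m \<longrightarrow> \<not> (\<forall>p\<in>nsets Q 2. c p)) \<and>
                (\<forall>Q\<subseteq>B. (\<forall>p\<in>nsets Q 2. \<not> c p) \<longrightarrow> card Q < s)"
  using assms
proof (induction s arbitrary: W)
  case 0
  then show ?case by simp
next
  case (Suc s)
  show ?case
  proof (cases "\<exists>Q\<subseteq>W. card Q = m \<and> (\<forall>p\<in>nsets Q 2. c p)")
    case False
    then show ?thesis by (intro exI[of _ "{}"]) auto
  next
    case True
    then obtain R where R: "R \<subseteq> W" "card R = m" "\<forall>p\<in>nsets R 2. c p" by blast
    have "finite R" using R Suc.prems finite_subset by blast
    then have "card (W - R) < s * m"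
      using R Suc.prems card_mono[OF \<open>finite W\<close> R(1)] by (simp add: card_Diff_subset)
    then obtain B where B: "B \<subseteq> W - R"
      "\<And>Q. Q \<subseteq> W - R - B \<Longrightarrow> card Q = m \<Longrightarrow> \<not> (\<forall>p\<in>nsets Q 2. c p)"
      "\<And>Q. Q \<subseteq> B \<Longrightarrow> (\<forall>p\<in>nsets Q 2. \<not> c p) \<Longrightarrow> card Q < s"
      using Suc.IH[of "W - R"] Suc.prems by auto
    have "card Q < Suc s" if Q: "Q \<subseteq> R \<union> B" "\<forall>p\<in>nsets Q 2. \<not> c p" for Q
    proof -
      have "finite Q" using Q R B Suc.prems by (meson Diff_subset finite_Un finite_subset)
      have "card (Q - R) < s"
        using Q B(3)[of "Q - R"] by (auto simp: nsets_def)
      moreover have "card (Q \<inter> R) \<le> 1"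
      proof (rule ccontr)
        assume "\<not> card (Q \<inter> R) \<le> 1"
        then have "2 \<le> card (Q \<inter> R)" by simp
        then obtain p where "p \<subseteq> Q \<inter> R" "card p = 2" "finite p"
          using obtain_subset_with_card_n by blast
        then have "p \<in> nsets Q 2" "p \<in> nsets R 2" by (auto simp: nsets_def)
        then show False using Q R by blast
      qed
      moreover have "card Q = card (Q - R) + card (Q \<inter> R)"
        using \<open>finite Q\<close> by (metis add.commute card_Int_Diff)
      ultimately show ?thesis by simp
    qed
    moreover have "W - (R \<union> B) = W - R - B" by blast
    ultimately show ?thesis
      using R B by (intro exI[of _ "R \<union> B"]) auto
  qed
qed

text \<open>In a monochromatic \<open>K\<close> through \<open>u\<close> and \<open>v\<close>, the
  set \<open>Q = K - {u, v}\<close> would lie on one side of \<open>B\<close>, while the link of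
  \<open>u\<close> on \<open>Q\<close> has the very colour that is excluded on this side.\<close>

lemma recolour_light_pair:
  assumes fin: "finite {w. {u, v, w} \<in> edges H}" and light: "card {w. {u, v, w} \<in> edges H} < m * m"
    and uv: "u \<noteq> v"
  shows "\<exists>\<chi>'. (\<forall>e. \<not> {u, v} \<subseteq> e \<longrightarrow> \<chi>' e = \<chi> e) \<and>
     (\<forall>K. {u, v} \<subseteq> K \<longrightarrow> card K = m + 2 \<longrightarrow> hyperclique H K \<longrightarrow> \<not> mono_triples \<chi>' K)"
proof -
  define W where "W = {w. {u, v, w} \<in> edges H}"
  obtain B where B: "B \<subseteq> W"
    "\<And>Q. Q \<subseteq> W - B \<Longrightarrow> card Q = m \<Longrightarrow> \<not> (\<forall>p\<in>nsets Q 2. \<chi> (insert u p))"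
    "\<And>Q. Q \<subseteq> B \<Longrightarrow> (\<forall>p\<in>nsets Q 2. \<not> \<chi> (insert u p)) \<Longrightarrow> card Q < m"
    using split_cliques[of W m m "\<lambda>p. \<chi> (insert u p)"] fin light unfolding W_def by blast
  \<comment> \<open>For \<open>e = {u, v, w}\<close> the condition says \<open>w \<notin> B\<close>;
    stated for \<open>e - {u, v}\<close>, it does not have to name \<open>w\<close>.\<close>
  define \<chi>' where "\<chi>' e = (if {u, v} \<subseteq> e then e - {u, v} \<subseteq> - B else \<chi> e)" for e
  have "\<not> mono_triples \<chi>' K" if K: "{u, v} \<subseteq> K" "card K = m + 2" "hyperclique H K" for K
  proof
    assume "mono_triples \<chi>' K"
    then obtain c where c: "\<And>e. e \<in> nsets K 3 \<Longrightarrow> \<chi>' e = c" unfolding mono_triples_def by blast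
    define Q where "Q = K - {u, v}"
    have "finite K" using K by (intro card_ge_0_finite) simp
    then have "card Q = m" using K uv by (simp add: Q_def card_Diff_subset)
    have uvw: "{u, v, w} \<in> nsets K 3" if "w \<in> Q" for w
      using that K uv by (auto simp: Q_def nsets_def)
    then have QW: "Q \<subseteq> W" using K unfolding W_def hyperclique_def by blast
    \<comment> \<open>Triples \<open>insert u p\<close> avoid \<open>v\<close>, so they keep their
      old colour. The link of \<open>v\<close> is never consulted.\<close>
    have link: "\<chi> (insert u p) = c" if p: "p \<in> nsets Q 2" for p
    proof -
      have "u \<notin> p" "v \<notin> p" "finite p" "card p = 2" "p \<subseteq> K"
        using p by (auto simp: Q_def nsets_def)
      then have "insert u p \<in> nsets K 3" using K by (auto simp: nsets_def)
      then show ?thesis using c[of "insert u p"] \<open>v \<notin> p\<close> uv by (auto simp: \<chi>'_def)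
    qed
    have side: "w \<notin> B \<longleftrightarrow> c" if "w \<in> Q" for w
      using c[OF uvw[OF that]] that by (auto simp: \<chi>'_def Q_def)
    show False
    proof (cases c)
      case True
      then have "Q \<subseteq> W - B" using side QW by blast
      then show False using B(2) \<open>card Q = m\<close> link True by blast
    next
      case False
      then have "Q \<subseteq> B" using side by blast
      then show False using B(3)[of Q] \<open>card Q = m\<close> link False by blast
    qed
  qed
  then show ?thesis by (intro exI[of _ \<chi>']) (simp add: \<chi>'_def)
qed

text \<open>\<open>S\<close> holds the pairs still to be repaired, and the last hypothesis is the
  invariant. Repairing \<open>p\<close> preserves it: in a clique without \<open>p\<close> no triple
  changes colour, and a clique through \<open>p\<close> is no longer monochromatic.\<close>

lemma recolour_light_pairs:
  assumes "finite S" "finite (edges H)" "\<And>p. p \<in> S \<Longrightarrow> card p = 2"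
    and "\<And>p. p \<in> S \<Longrightarrow> card {e \<in> edges H. p \<subseteq> e} < m * m"
    and "\<And>e. e \<in> edges H \<Longrightarrow> card e = 3"
    and "\<And>K. card K = m + 2 \<Longrightarrow> hyperclique H K \<Longrightarrow> \<forall>p\<in>S. \<not> p \<subseteq> K \<Longrightarrow> \<not> mono_triples \<chi> K"
  shows "\<exists>\<chi>'. \<forall>K. card K = m + 2 \<longrightarrow> hyperclique H K \<longrightarrow> \<not> mono_triples \<chi>' K"
  using assms
proof (induction S arbitrary: \<chi> rule: finite_induct)
  case empty
  then show ?case by blast
next
  case (insert p S)
  obtain u v where uv: "p = {u, v}" "u \<noteq> v"
    using insert.prems(2)[of p] by (auto simp: card_2_iff)
  define W where "W = {w. {u, v, w} \<in> edges H}"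
  have W: "w \<noteq> u" "w \<noteq> v" if "w \<in> W" for w
    using that insert.prems(4)[of "{u, v, w}"] uv
    by (auto simp: W_def insert_commute card_insert_if split: if_splits)
  \<comment> \<open>This turns the bound on edges through \<open>p\<close> into a bound on the
    common neighbourhood; \<open>W\<close> avoids \<open>u\<close> and \<open>v\<close> because
    edges have three elements.\<close>
  have inj: "inj_on (\<lambda>w. {u, v, w}) W"
  proof (rule inj_onI)
    fix w w' assume "w \<in> W" "w' \<in> W" "{u, v, w} = {u, v, w'}"
    then show "w = w'" using W by blast
  qed
  have sub: "(\<lambda>w. {u, v, w}) ` W \<subseteq> {e \<in> edges H. p \<subseteq> e}" by (auto simp: W_def uv)
  have finE: "finite {e \<in> edges H. p \<subseteq> e}" using insert.prems(1) by simp
  have "finite W" using inj sub finE by (rule inj_on_finite)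
  moreover have "card W < m * m"
    using card_inj_on_le[OF inj sub finE] insert.prems(3)[of p] by simp
  ultimately obtain \<chi>' where \<chi>': "\<And>e. \<not> p \<subseteq> e \<Longrightarrow> \<chi>' e = \<chi> e"
    "\<And>K. p \<subseteq> K \<Longrightarrow> card K = m + 2 \<Longrightarrow> hyperclique H K \<Longrightarrow> \<not> mono_triples \<chi>' K"
    using recolour_light_pair[of u v H m \<chi>] uv unfolding W_def by auto
  show ?case
  proof (rule insert.IH)
    show "finite (edges H)" by fact
    show "card q = 2" if "q \<in> S" for q using insert.prems(2) that by blast
    show "card {e \<in> edges H. q \<subseteq> e} < m * m" if "q \<in> S" for q
      using insert.prems(3) that by blast
    show "card e = 3" if "e \<in> edges H" for e using insert.prems(4) that .
    fix K assume K: "card K = m + 2" "hyperclique H K" "\<forall>p\<in>S. \<not> p \<subseteq> K"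
    show "\<not> mono_triples \<chi>' K"
    proof (cases "p \<subseteq> K")
      case True
      then show ?thesis using \<chi>' K by blast
    next
      case False
      then have "\<chi>' e = \<chi> e" if "e \<in> nsets K 3" for e
        using that by (intro \<chi>') (auto simp: nsets_def)
      then have "mono_triples \<chi>' K \<longleftrightarrow> mono_triples \<chi> K"
        by (simp add: mono_triples_def)
      then show ?thesis using insert.prems(5)[of K] K False by blast
    qed
  qed
qed

section \<open>Heavy pairs: proper colouring and double counting\<close>

text \<open>A proper colouring with the fewest colours has an edge between any two of its classes.\<close>

lemma proper_colouring:
  assumes finV: "finite V" and finP: "finite P" and PV: "P \<subseteq> nsets V 2"
    and few: "card P < Suc r choose 2"
  shows "\<exists>\<phi>. \<phi> ` V \<subseteq> {..<r} \<and> (\<forall>p\<in>P. inj_on \<phi> p)"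
proof -
  \<comment> \<open>Colours are taken from the vertex type, so that \<open>id\<close> is a proper
    colouring to start from.\<close>
  define proper :: "('a \<Rightarrow> 'a) \<Rightarrow> bool" where "proper f \<longleftrightarrow> (\<forall>p\<in>P. inj_on f p)" for f
  have "proper id" by (simp add: proper_def)
  then obtain f where f: "proper f" and min: "\<And>g. proper g \<Longrightarrow> card (f ` V) \<le> card (g ` V)"
    using ex_has_least_nat[of proper id "\<lambda>f. card (f ` V)"] by blast
  have "nsets (f ` V) 2 \<subseteq> (\<lambda>p. f ` p) ` P"
  proof
    fix q assume q: "q \<in> nsets (f ` V) 2"
    then obtain a b where ab: "q = {a, b}" "a \<noteq> b" "a \<in> f ` V" "b \<in> f ` V"
      by (auto simp: nsets_def card_2_iff)
    \<comment> \<open>Merging class \<open>b\<close> into class \<open>a\<close> saves a colour, so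
      by minimality some member of \<open>P\<close> joins the two classes.\<close>
    define g where "g x = (if f x = b then a else f x)" for x
    have "g ` V \<subseteq> f ` V - {b}" using ab by (auto simp: g_def)
    then have "card (g ` V) < card (f ` V)"
      using finV ab by (intro psubset_card_mono) auto
    then have "\<not> proper g" using min[of g] by auto
    then obtain p where p: "p \<in> P" "\<not> inj_on g p" by (auto simp: proper_def)
    then obtain x y where xy: "p = {x, y}" "x \<noteq> y"
      using PV by (fastforce simp: nsets_def card_2_iff)
    have "f x \<noteq> f y" using f p xy by (auto simp: proper_def)
    moreover have "g x = g y" using p xy by auto
    ultimately have "f ` p = q" using xy ab by (auto simp: g_def split: if_splits)
    then show "q \<in> (\<lambda>p. f ` p) ` P" using p by blast
  qed
  then have "card (nsets (f ` V) 2) \<le> card P"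
    using finP by (meson card_image_le card_mono finite_imageI le_trans)
  then have "card (f ` V) choose 2 < Suc r choose 2" using few by simp
  then have "card (f ` V) \<le> r"
    using binomial_right_mono[of "Suc r" "card (f ` V)" 2] by linarith
  then obtain h where h: "h ` f ` V \<subseteq> {..<r}" "inj_on h (f ` V)"
    using card_le_inj[of "f ` V" "{..<r}"] finV by auto
  have "inj_on (h \<circ> f) p" if "p \<in> P" for p
  proof (rule comp_inj_on)
    show "inj_on f p" using f that by (simp add: proper_def)
    have "f ` p \<subseteq> f ` V" using PV that unfolding nsets_def by blast
    with h(2) show "inj_on h (f ` p)" by (rule inj_on_subset)
  qed
  then show ?thesis using h by (intro exI[of _ "h \<circ> f"]) (simp add: image_comp)
qed

text \<open>Double counting of the incidences \<open>p \<subseteq> e\<close>: a triple contains only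
  three pairs.\<close>

lemma heavy_pairs_bound:
  assumes "finite E" "\<And>e. e \<in> E \<Longrightarrow> finite e \<and> card e = 3" "finite P"
    and "\<And>p. p \<in> P \<Longrightarrow> card p = 2 \<and> d \<le> card {e \<in> E. p \<subseteq> e}"
  shows "card P * d \<le> 3 * card E"
proof -
  have "card P * d \<le> (\<Sum>p\<in>P. card {e \<in> E. p \<subseteq> e})"
    using assms(4) sum_bounded_below[of P d "\<lambda>p. card {e \<in> E. p \<subseteq> e}"] by simp
  also have "\<dots> = (\<Sum>e\<in>E. card {p \<in> P. p \<subseteq> e})"
    using assms sum.swap_restrict[of P E "\<lambda>_ _. 1 :: nat" "\<lambda>p e. p \<subseteq> e"] by simp
  also have "\<dots> \<le> (\<Sum>e\<in>E. 3)"
  proof (rule sum_mono)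
    fix e assume "e \<in> E"
    then have e: "finite e" "card e = 3" using assms by auto
    then have "{p \<in> P. p \<subseteq> e} \<subseteq> nsets e 2"
      using assms(4) by (auto simp: nsets_def intro: finite_subset)
    then have "card {p \<in> P. p \<subseteq> e} \<le> card (nsets e 2)"
      using e by (intro card_mono finite_imp_finite_nsets)
    then show "card {p \<in> P. p \<subseteq> e} \<le> 3" using e by (simp add: card_nsets choose_two)
  qed
  finally show ?thesis by simp
qed

section \<open>Copies of complete 3-graphs as vertex sets\<close>

lemma edges_complete_kgraph: "edges (complete_kgraph k n) = nsets {..<n} k"
  by (auto simp: complete_kgraph_def nsets_def intro: finite_subset)

lemma verts_complete_kgraph: "verts (complete_kgraph k n) = {..<n}"
  by (simp add: complete_kgraph_def)

lemma nsets_image_inj: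
  assumes "inj_on f A"
  shows "nsets (f ` A) k = (\<lambda>e. f ` e) ` nsets A k"
proof -
  have "bij_betw (\<lambda>e. f ` e) (nsets A k) (nsets (f ` A) k)"
    using assms by (intro bij_betw_nsets) (simp add: bij_betw_def)
  then show ?thesis by (simp add: bij_betw_def)
qed

text \<open>Only the image of an embedding matters here: any bijection from \<open>{..<n}\<close>
  onto a clique maps triples onto triples.\<close>

lemma arrows_complete_iff:
  assumes "kgraph 3 H"
  shows "arrows H (complete_kgraph 3 n) \<longleftrightarrow>
    (\<forall>\<chi>. \<exists>K. card K = n \<and> hyperclique H K \<and> mono_triples \<chi> K)"
proof -
  have "(\<exists>f. embedding f (complete_kgraph 3 n) H \<and>
          (\<exists>c. \<forall>e\<in>edges (complete_kgraph 3 n). \<chi> (f ` e) = c)) \<longleftrightarrow>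
        (\<exists>K. card K = n \<and> hyperclique H K \<and> mono_triples \<chi> K)"
    (is "?L \<longleftrightarrow> ?R") for \<chi>
  proof
    assume ?L
    then obtain f c where f: "embedding f (complete_kgraph 3 n) H"
      and c: "\<forall>e\<in>nsets {..<n} 3. \<chi> (f ` e) = c"
      unfolding edges_complete_kgraph by blast
    have inj: "inj_on f {..<n}" and img: "f ` {..<n} \<subseteq> verts H"
        "\<forall>e\<in>nsets {..<n} 3. f ` e \<in> edges H"
      using f unfolding embedding_def edges_complete_kgraph verts_complete_kgraph by blast+
    have "mono_triples \<chi> (f ` {..<n})"
      using c unfolding mono_triples_def nsets_image_inj[OF inj] by blast
    moreover have "hyperclique H (f ` {..<n})"
      using img unfolding hyperclique_def nsets_image_inj[OF inj] by blast
    moreover have "card (f ` {..<n}) = n" using inj by (simp add: card_image)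
    ultimately show ?R by blast
  next
    assume ?R
    then obtain K where K: "card K = n" "hyperclique H K" "mono_triples \<chi> K" by blast
    then have "finite K"
      using assms unfolding hyperclique_def kgraph_def by (blast intro: finite_subset)
    then obtain f where "bij_betw f {..<n} K"
      using K ex_bij_betw_nat_finite[of K] by (auto simp: atLeast0LessThan)
    then have f: "inj_on f {..<n}" "f ` {..<n} = K" by (auto simp: bij_betw_def)
    have img: "f ` e \<in> nsets K 3" if "e \<in> nsets {..<n} 3" for e
      using nsets_image_inj[OF f(1), of 3] f(2) that by blast
    have "embedding f (complete_kgraph 3 n) H"
      using K(2) f img
      unfolding embedding_def edges_complete_kgraph verts_complete_kgraph hyperclique_def by blast
    moreover have "\<exists>c. \<forall>e\<in>edges (complete_kgraph 3 n). \<chi> (f ` e) = c"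
      using K(3) img unfolding edges_complete_kgraph mono_triples_def by blast
    ultimately show ?L by blast
  qed
  then show ?thesis by (simp add: arrows_def)
qed

section \<open>The lower bound\<close>

lemma arrows_edges_lower_bound:
  fixes H :: "'a hypergraph"
  assumes H: "kgraph 3 H" and arr: "arrows H (complete_kgraph 3 (m + 2))"
  shows "(ramsey_number 3 (complete_kgraph 3 (m + 2)) choose 2) * (m * m) \<le> 3 * card (edges H)"
proof (cases "ramsey_number 3 (complete_kgraph 3 (m + 2))")
  \<comment> \<open>Here the binomial coefficient vanishes. Otherwise \<open>r\<close> is one less
    than the Ramsey number.\<close>
  case 0
  then show ?thesis unfolding 0 by (simp add: numeral_2_eq_2)
next
  case (Suc r)
  define V E where "V = verts H" and "E = edges H"
  have finV: "finite V" and EV: "E \<subseteq> Pow V" and card3: "\<And>e. e \<in> E \<Longrightarrow> card e = 3"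
    using H unfolding kgraph_def V_def E_def by blast+
  have E3: "finite e \<and> card e = 3" if "e \<in> E" for e
    using that EV card3 finite_subset[OF _ finV] by blast
  have finE: "finite E" using EV finV by (meson finite_Pow_iff finite_subset)
  define P where "P = {p \<in> nsets V 2. m * m \<le> card {e \<in> E. p \<subseteq> e}}"
  define S where "S = nsets V 2 - P"
  have finN: "finite (nsets V 2)" using finV by (rule finite_imp_finite_nsets)
  then have finP: "finite P" and finS: "finite S" by (simp_all add: P_def S_def)
  have PV: "P \<subseteq> nsets V 2" by (simp add: P_def)
  have "\<not> card P < Suc r choose 2"
  proof
    assume "card P < Suc r choose 2"
    from proper_colouring[OF finV finP PV this]
    obtain \<phi> where \<phi>: "\<phi> ` V \<subseteq> {..<r}" "\<forall>p\<in>P. inj_on \<phi> p"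
      by (elim exE conjE)
    have "\<not> arrows (complete_kgraph 3 r) (complete_kgraph 3 (m + 2))"
      using Suc not_less_Least[of r "\<lambda>N. arrows (complete_kgraph 3 N) (complete_kgraph 3 (m + 2))"]
      by (simp add: ramsey_number_def)
    then obtain \<chi>0 where \<chi>0: "\<And>K. card K = m + 2 \<Longrightarrow> hyperclique (complete_kgraph 3 r) K \<Longrightarrow>
        \<not> mono_triples \<chi>0 K"
      unfolding arrows_complete_iff[OF kgraph_complete_kgraph] by blast
    \<comment> \<open>The colouring to be repaired is the pullback of \<open>\<chi>0\<close> along
      \<open>\<phi>\<close>. Where \<open>\<phi>\<close> is not injective on an edge, its value is
      arbitrary; this is harmless, since only cliques without light pairs are examined and
      \<open>\<phi>\<close> is injective on those.\<close>
    have "\<exists>\<chi>. \<forall>K. card K = m + 2 \<longrightarrow> hyperclique H K \<longrightarrow> \<not> mono_triples \<chi> K"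
    proof (rule recolour_light_pairs[OF finS])
      fix K assume K: "card K = m + 2" "hyperclique H K" "\<forall>p\<in>S. \<not> p \<subseteq> K"
      have KV: "K \<subseteq> V" using K by (simp add: hyperclique_def V_def)
      have inj: "inj_on \<phi> K"
      proof (rule inj_onI, rule ccontr)
        fix x y assume xy: "x \<in> K" "y \<in> K" "\<phi> x = \<phi> y" "x \<noteq> y"
        then have "{x, y} \<in> nsets V 2" using KV by (auto simp: nsets_def)
        moreover have "{x, y} \<notin> S" using K(3) xy(1,2) by auto
        ultimately have "{x, y} \<in> P" by (simp add: S_def)
        with \<phi>(2) have "inj_on \<phi> {x, y}" by (rule bspec)
        then show False using xy by simp
      qed
      have "\<phi> ` K \<subseteq> {..<r}" using \<phi>(1) KV by blast
      then have "hyperclique (complete_kgraph 3 r) (\<phi> ` K)"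
        unfolding hyperclique_def edges_complete_kgraph verts_complete_kgraph by (simp add: nsets_mono)
      then have "\<not> mono_triples \<chi>0 (\<phi> ` K)"
        using \<chi>0 K inj by (simp add: card_image)
      then show "\<not> mono_triples (\<lambda>e. \<chi>0 (\<phi> ` e)) K"
        using inj by (simp add: mono_triples_def nsets_image_inj)
    qed (use finE E3 in \<open>auto simp: S_def P_def E_def nsets_def\<close>)
    then show False
      using arr unfolding arrows_complete_iff[OF H] by blast
  qed
  then have "(Suc r choose 2) * (m * m) \<le> card P * (m * m)" by simp
  also have "\<dots> \<le> 3 * card E"
    using finE E3 finP by (rule heavy_pairs_bound) (auto simp: P_def nsets_def)
  finally show ?thesis using Suc by (simp add: E_def)
qed

theorem theorem1:
  fixes n :: nat
  assumes "n \<ge> 4"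
  shows "real (size_ramsey_number 3 (complete_kgraph 3 n))
           \<ge> (real n)\<^sup>2 / 96 * real (ramsey_number 3 (complete_kgraph 3 n) choose 2)"
proof -
  let ?G = "complete_kgraph 3 n"
  define R where "R = real (ramsey_number 3 ?G choose 2)"
  define m where "m = n - 2"
  have n: "n = m + 2" using assms by (simp add: m_def)
  have "\<exists>k. \<exists>H :: nat hypergraph. kgraph 3 H \<and> arrows H ?G \<and> k = card (edges H)"
    using arrows_complete_kgraph_ex kgraph_complete_kgraph by blast
  then have "\<exists>H :: nat hypergraph. kgraph 3 H \<and> arrows H ?G \<and>
      size_ramsey_number 3 ?G = card (edges H)"
    unfolding size_ramsey_number_def by (rule LeastI_ex)
  then obtain H :: "nat hypergraph" where H: "kgraph 3 H" "arrows H ?G"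
    and size: "size_ramsey_number 3 ?G = card (edges H)" by blast
  have "(ramsey_number 3 ?G choose 2) * (m * m) \<le> 3 * size_ramsey_number 3 ?G"
    using arrows_edges_lower_bound[of H m] H unfolding n size[unfolded n] by blast
  then have "real ((ramsey_number 3 ?G choose 2) * (m * m)) \<le> real (3 * size_ramsey_number 3 ?G)"
    by (rule of_nat_mono)
  then have bound: "(real m)\<^sup>2 / 3 * R \<le> real (size_ramsey_number 3 ?G)"
    by (simp add: R_def power2_eq_square field_simps)
  \<comment> \<open>From \<open>n \<ge> 4\<close> follows \<open>n \<le> 2 * m\<close>, so the bound
    proved is at least \<open>n\<^sup>2 / 12\<close> times the binomial coefficient, eight times
    what is claimed.\<close>
  have "(real n)\<^sup>2 \<le> (2 * real m)\<^sup>2"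
    using assms by (intro power_mono) (auto simp: m_def)
  then have "(real n)\<^sup>2 \<le> 4 * (real m)\<^sup>2" by (simp add: power_mult_distrib)
  moreover have "0 \<le> (real m)\<^sup>2" by simp
  ultimately have "(real n)\<^sup>2 / 96 \<le> (real m)\<^sup>2 / 3" by linarith
  then have "(real n)\<^sup>2 / 96 * R \<le> (real m)\<^sup>2 / 3 * R"
    by (rule mult_right_mono) (simp add: R_def)
  with bound show ?thesis by (simp add: R_def)
qed

end
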